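(* Let $\mathfrak A\subset\mathcal A^{\mathbb Z^D}$ be a subshift and let $d\in\{0,\dots,D\}$. If $\mathbf a\in\widetilde{\mathfrak A}$ has a projective $d$-pole, then $\mathbf a$ has an essential defect.
   Context: **Subshifts and defects.** $\mathcal A$ is a finite alphabet, $D\ge1$; $\mathcal A^{\mathbb Z^D}$ carries the product topology; $\sigma^{\mathsf v}(\mathbf a)_{\mathsf z}=a_{\mathsf z+\mathsf v}$; a subshift is a closed shift-invariant subset. $\mathbb B(r)=\{-r,\dots,r\}^D$, $\mathbb B(\mathsf z,r)=\mathsf z+\mathbb B(r)$; for $\mathbb U\subset\mathbb Z^D$, $\mathfrak A_{\mathbb U}=\{\mathbf a_{\mathbb U}:\mathbf a\in\mathfrak A\}$, patterns on translates of $\mathbb U$ being identified with patterns on $\mathbb U$; $\mathfrak A_{(r)}=\mathfrak A_{\mathbb B(r)}$. $\mathcal F_{\mathbf a}(\mathsf z)=\max\{r\in\mathbb N:\mathbf a_{\mathbb B(\mathsf z,r)}\in\mathfrak A_{(r)}\}\in\mathbb N\cup\{\infty\}$; $\widetilde{\mathfrak A}=\{\mathbf a:\sup_{\mathsf z}\mathcal F_{\mathbf a}(\mathsf z)=\infty\}$; $\mathbb G_r(\mathbf a)=\{\mathsf z:\mathcal F_{\mathbf a}(\mathsf z)\ge r\}$. $\mathbf a$ has a removable defect if there are $r>0$ and $\mathbf a'\in\mathfrak A$ with $a'_{\mathsf z}=a_{\mathsf z}$ for all $\mathsf z\in\mathbb G_r(\mathbf a)$; otherwise it has an essential defect. **Equivariant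 cocycles.** $\mathbf Y$ is the canonical cell decomposition of $\mathbb R^D$ with vertex set $\mathbb Z^D$ and top cells the unit cubes $\mathsf z+[0,1]^D$; $\mathbf Y^d$ is its set of (oriented) $d$-cells, $\mathbb Z[\mathbf Y^d]$ the group of $d$-chains (with $\mathbb Z[\mathbf Y^{-1}]=\mathbb Z[\mathbf Y^{D+1}]=\{0\}$), $\partial_d$ the cubical boundary, $\Upsilon_d^{\mathsf z}$ translation by $\mathsf z$ on $d$-chains. Let $(\mathcal G,+)$ be an abelian topological group. $\mathcal Z^d_{\mathrm{eq}}(\mathfrak A,\mathcal G)$ is the group of continuous $C:\mathbb Z[\mathbf Y^d]\times\mathfrak A\to\mathcal G$, additive in the first variable, with $C(\zeta,\sigma^{\mathsf z}(\mathbf a))=C(\Upsilon_d^{\mathsf z}(\zeta),\mathbf a)$ and $C(\partial_{d+1}\beta,\mathbf a)=0$ for all $\zeta\in\mathbb Z[\mathbf Y^d]$, $\beta\in\mathbb Z[\mathbf Y^{d+1}]$, $\mathsf z\in\mathbb Z^D$, $\mathbf a\in\mathfrak A$. **Local determination.** Let $\mathbf Y_0^d$ be the set of $d$-cells $x=\{t\in[0,1]^D:t_i=0\ \forall i\in I\}$, $I\subset\{1,\dots,D\}$, $|I|=D-d$. For such $x$ put $\partial_x\mathbb B(r)=\{\mathsf u\in\mathbb B(r):u_i<r\ \forall i\in I\}$. Every $y\in\mathbf Y^d$ is uniquely $\Upsilon_d^{\mathsf z}(x)$ with $x\in\mathbf Y^d_0$ and $\mathsf z\in\mathbb Z^D$.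 $C$ is locally determined with radius $r>0$ if for each $x\in\mathbf Y^d_0$ there is a local rule $c_x:\mathfrak A_{\partial_x\mathbb B(r)}\to\mathcal G$ with $C(\Upsilon^{\mathsf z}_d(x),\mathbf a)=c_x(\mathbf a_{\mathsf z+\partial_x\mathbb B(r)})$ for all $\mathbf a\in\mathfrak A$, $\mathsf z\in\mathbb Z^D$. If so, this formula also defines $C(y,\mathbf a)$ for $\mathbf a\in\widetilde{\mathfrak A}$ and every $d$-cell $y$ with all vertices in $\mathbb G_r(\mathbf a)$. **Poles.** If $C\in\mathcal Z^d_{\mathrm{eq}}(\mathfrak A,\mathcal G)$ is locally determined with radius $r$, then $\mathbf a\in\widetilde{\mathfrak A}$ has a $C$-pole of range $r$ if there is a $d$-cycle $\zeta$ (a $d$-chain with $\partial_d\zeta=0$) consisting of $d$-cells with all vertices in $\mathbb G_r(\mathbf a)$ such that $C(\zeta,\mathbf a)\ne0$. It has a projective $C$-pole if it has a $C$-pole of range $r$ for all large enough $r\in\mathbb N$. It has a projective $(\mathcal G,d)$-pole if it has a projective $C$-pole for some $C\in\mathcal Z^d_{\mathrm{eq}}(\mathfrak A,\mathcal G)$, and a projective $d$-pole if it has a projective $(\mathcal G,d)$-pole for some abelian group $\mathcal G$.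
   Formalization: For d = 0, a cycle is also required to have coefficient sum 0 (reduced homology); otherwise a single vertex and a nonzero constant cocycle give every element of a nonempty subshift a projective 0-pole, though its defect is removable. *)

theory Defs
  imports "HOL-Analysis.Analysis" "HOL-Library.Poly_Mapping"
begin

(* The lattice Z^D is int ^ 'n with D = CARD('n) >= 1. The linear order on 'n is the order of the
   coordinate axes 1, ..., D; it only serves to fix the signs of the cubical boundary.
   The finite alphabet is a type 'a :: finite. *)

type_synonym ('a, 'n) config = "int ^ 'n \<Rightarrow> 'a"

section \<open>Subshifts and defects\<close>

definition full_shift :: "('a, 'n::finite) config topology" where
  "full_shift = product_topology (\<lambda>_. discrete_topology UNIV) UNIV"

definition shift :: "int ^ 'n \<Rightarrow> ('a, 'n::finite) config \<Rightarrow> ('a, 'n) config" where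
  "shift v a = (\<lambda>z. a (z + v))"

definition subshift :: "('a, 'n::finite) config set \<Rightarrow> bool" where
  "subshift A \<longleftrightarrow> closedin full_shift A \<and> (\<forall>v. shift v ` A = A)"

definition cube :: "nat \<Rightarrow> (int ^ 'n::finite) set" where
  "cube r = {u. \<forall>i. \<bar>u $ i\<bar> \<le> int r}"

(* The pattern of a on the translate z + U, regarded as a pattern on U, is restrict (shift z a) U. *)
definition patterns :: "('a, 'n::finite) config set \<Rightarrow> (int ^ 'n) set \<Rightarrow> ('a, 'n) config set" where
  "patterns A U = (\<lambda>b. restrict b U) ` A"

(* The set of admissible radii is closed downwards, so its supremum in enat is the maximum, or
   infinity if all radii are admissible. The convention for the empty set (not even the letter at z
   occurs in A) is 0, which is immaterial because only the sets good A r a with r > 0 are used. *)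
definition admissible_radius ::
    "('a, 'n::finite) config set \<Rightarrow> ('a, 'n) config \<Rightarrow> int ^ 'n \<Rightarrow> enat" where
  "admissible_radius A a z =
     (SUP r \<in> {r. restrict (shift z a) (cube r) \<in> patterns A (cube r)}. enat r)"

definition defect_configs :: "('a, 'n::finite) config set \<Rightarrow> ('a, 'n) config set" where
  "defect_configs A = {a. (SUP z. admissible_radius A a z) = \<infinity>}"

definition good :: "('a, 'n::finite) config set \<Rightarrow> nat \<Rightarrow> ('a, 'n) config \<Rightarrow> (int ^ 'n) set" where
  "good A r a = {z. admissible_radius A a z \<ge> enat r}"

definition removable_defect :: "('a, 'n::finite) config set \<Rightarrow> ('a, 'n) config \<Rightarrow> bool" where
  "removable_defect A a \<longleftrightarrow> (\<exists>r>0. \<exists>a'\<in>A. \<forall>z\<in>good A r a. a' z = a z)"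

definition essential_defect :: "('a, 'n::finite) config set \<Rightarrow> ('a, 'n) config \<Rightarrow> bool" where
  "essential_defect A a \<longleftrightarrow> \<not> removable_defect A a"

section \<open>The canonical cell decomposition\<close>

(* (z, J) encodes the positively oriented cell z + x, where x is the cell at the origin with set J
   of free directions, that is x = {t in [0,1]^D. t_i = 0 for all i in I} with I = - J. The cell
   with the opposite orientation is the negative of this one in the chain group. *)
type_synonym 'n cell = "(int ^ 'n) \<times> 'n set"
type_synonym 'n chain = "'n cell \<Rightarrow>\<^sub>0 int"

definition cell_body :: "'n::finite cell \<Rightarrow> (real ^ 'n) set" where
  "cell_body = (\<lambda>(z, J). (\<lambda>t. (\<chi> i. of_int (z $ i)) + t) `
     {t. (\<forall>i. 0 \<le> t $ i \<and> t $ i \<le> 1) \<and> (\<forall>i\<in>-J. t $ i = 0)})"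

definition cell_vertices :: "'n::finite cell \<Rightarrow> (int ^ 'n) set" where
  "cell_vertices y = {v. (\<chi> i. of_int (v $ i)) \<in> cell_body y}"

definition cells :: "nat \<Rightarrow> 'n::finite cell set" where
  "cells d = {(z, J). card J = d}"

definition cell_chains :: "nat \<Rightarrow> 'n::finite chain set" where
  "cell_chains d = {\<zeta>. Poly_Mapping.keys \<zeta> \<subseteq> cells d}"

definition translate_chain :: "int ^ 'n \<Rightarrow> 'n::finite chain \<Rightarrow> 'n chain" where
  "translate_chain v = frag_extend (\<lambda>(z, J). frag_of (z + v, J))"

(* For J = {j_1 < ... < j_d} the faces orthogonal to j_k carry the sign (-1)^(k-1).
   The boundary of every 0-chain is 0. *)
definition cell_boundary :: "'n::{finite,linorder} cell \<Rightarrow> 'n chain" where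
  "cell_boundary = (\<lambda>(z, J). \<Sum>j\<in>J. frag_cmul ((-1) ^ card {i\<in>J. i < j})
     (frag_of (z + axis j 1, J - {j}) - frag_of (z, J - {j})))"

definition cubical_boundary :: "'n::{finite,linorder} chain \<Rightarrow> 'n chain" where
  "cubical_boundary = frag_extend cell_boundary"

(* In degree d >= 1 these are just the d-cycles. In degree 0, where every chain has boundary 0, the
   coefficients are moreover required to sum to 0 (reduced homology). Otherwise a single vertex
   would be a 0-cycle on which a nonzero constant cocycle does not vanish, so that every element
   of a nonempty subshift would have a projective 0-pole. *)
definition reduced_cycle :: "nat \<Rightarrow> 'n::{finite,linorder} chain \<Rightarrow> bool" where
  "reduced_cycle d \<zeta> \<longleftrightarrow> \<zeta> \<in> cell_chains d \<and> cubical_boundary \<zeta> = 0 \<and>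
     (d = 0 \<longrightarrow> (\<Sum>y\<in>Poly_Mapping.keys \<zeta>. Poly_Mapping.lookup \<zeta> y) = 0)"

section \<open>Equivariant cocycles and local determination\<close>

definition eq_cocycle :: "('a, 'n::{finite,linorder}) config set \<Rightarrow> nat \<Rightarrow>
    ('n chain \<Rightarrow> ('a, 'n) config \<Rightarrow> 'g::topological_ab_group_add) \<Rightarrow> bool" where
  "eq_cocycle A d C \<longleftrightarrow>
     continuous_map (prod_topology (discrete_topology (cell_chains d)) (subtopology full_shift A))
       euclidean (\<lambda>(\<zeta>, a). C \<zeta> a) \<and>
     (\<forall>a\<in>A. \<forall>\<zeta>\<in>cell_chains d. \<forall>\<zeta>'\<in>cell_chains d. C (\<zeta> + \<zeta>') a = C \<zeta> a + C \<zeta>' a) \<and>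
     (\<forall>a\<in>A. \<forall>\<zeta>\<in>cell_chains d. \<forall>z. C \<zeta> (shift z a) = C (translate_chain z \<zeta>) a) \<and>
     (\<forall>a\<in>A. \<forall>\<beta>\<in>cell_chains (Suc d). C (cubical_boundary \<beta>) a = 0)"

definition partial_cube :: "'n::finite set \<Rightarrow> nat \<Rightarrow> (int ^ 'n) set" where
  "partial_cube J r = {u \<in> cube r. \<forall>i\<in>-J. u $ i < int r}"

definition local_rule :: "('a, 'n::{finite,linorder}) config set \<Rightarrow> nat \<Rightarrow>
    ('n chain \<Rightarrow> ('a, 'n) config \<Rightarrow> 'g) \<Rightarrow> nat \<Rightarrow>
    ('n set \<Rightarrow> ('a, 'n) config \<Rightarrow> 'g) \<Rightarrow> bool" where
  "local_rule A d C r c \<longleftrightarrow> r > 0 \<and>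
     (\<forall>J. card J = d \<longrightarrow> (\<forall>a\<in>A. \<forall>z.
        C (frag_of (z, J)) a = c J (restrict (shift z a) (partial_cube J r))))"

definition int_scale :: "int \<Rightarrow> 'g \<Rightarrow> 'g::ab_group_add" where
  "int_scale k g = (\<Sum>_<nat k. g) - (\<Sum>_<nat (- k). g)"

(* The value at (\<zeta>, a) of the additive extension of the local rule c of radius r; here a need
   not belong to the subshift. *)
definition rule_value :: "nat \<Rightarrow> ('n set \<Rightarrow> ('a, 'n) config \<Rightarrow> 'g) \<Rightarrow>
    'n::finite chain \<Rightarrow> ('a, 'n) config \<Rightarrow> 'g::ab_group_add" where
  "rule_value r c \<zeta> a = (\<Sum>(z, J)\<in>Poly_Mapping.keys \<zeta>.
     int_scale (Poly_Mapping.lookup \<zeta> (z, J)) (c J (restrict (shift z a) (partial_cube J r))))"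

section \<open>Poles\<close>

(* A local rule of radius r for C is unique on the admissible patterns, and only these enter
   rule_value for cells with all vertices in good A r a; so the choice of c does not matter. *)
definition has_pole :: "('a, 'n::{finite,linorder}) config set \<Rightarrow> nat \<Rightarrow>
    ('n chain \<Rightarrow> ('a, 'n) config \<Rightarrow> 'g::topological_ab_group_add) \<Rightarrow> nat \<Rightarrow>
    ('a, 'n) config \<Rightarrow> bool" where
  "has_pole A d C r a \<longleftrightarrow> (\<exists>c. local_rule A d C r c \<and>
     (\<exists>\<zeta>. reduced_cycle d \<zeta> \<and> (\<forall>y\<in>Poly_Mapping.keys \<zeta>. cell_vertices y \<subseteq> good A r a) \<and>
       rule_value r c \<zeta> a \<noteq> 0))"

(* Since HOL cannot quantify over types, the abelian topological group is passed as a type. *)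
definition has_projective_pole :: "'g::topological_ab_group_add itself \<Rightarrow>
    ('a, 'n::{finite,linorder}) config set \<Rightarrow> nat \<Rightarrow> ('a, 'n) config \<Rightarrow> bool" where
  "has_projective_pole G A d a \<longleftrightarrow>
     (\<exists>C :: 'n chain \<Rightarrow> ('a, 'n) config \<Rightarrow> 'g. eq_cocycle A d C \<and>
       (\<forall>\<^sub>F r in sequentially. has_pole A d C r a))"

end

theory Submission
  imports Defs
begin

text \<open>Let \<open>a'\<close> be an element of the subshift that agrees with \<open>a\<close> on \<open>good A r a\<close>, and let a
  cocycle \<open>C\<close> be locally determined with radius \<open>s\<close>. On the points of \<open>good A (r + s) a\<close>, the local
  rule of \<open>C\<close> of radius \<open>r + s\<close> takes the same values at \<open>a\<close> as \<open>C\<close> does at \<open>a'\<close>. As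
  the space is contractible, every (reduced) cycle is a boundary in the whole grid, where \<open>a'\<close> is
  defined without defects; hence \<open>C\<close> vanishes on it, and there is no pole of range \<open>r + s\<close>.\<close>

section \<open>Signed sums over integer intervals\<close>

text \<open>One of the two sums is always empty; with this sign it telescopes on both sides of \<open>0\<close>.\<close>

definition int_sum :: "(int \<Rightarrow> 'b::ab_group_add) \<Rightarrow> int \<Rightarrow> 'b" where
  "int_sum f n = (\<Sum>k\<in>{0..<n}. f k) - (\<Sum>k\<in>{n..<0}. f k)"

lemma int_sum_0 [simp]: "int_sum f 0 = 0"
  by (simp add: int_sum_def)

lemma int_sum_plus1: "int_sum f (n + 1) = int_sum f n + f n"
proof (cases "n \<ge> 0")
  case True
  then have "{0..<n + 1} = insert n {0..<n}" by auto
  with True show ?thesis by (simp add: int_sum_def add.commute)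
next
  case False
  then have "{n..<0} = insert n {n + 1..<0}" by auto
  with False show ?thesis by (simp add: int_sum_def)
qed

lemma int_sum_telescope: "int_sum (\<lambda>k. g (k + 1) - g k) n = g n - g 0"
proof (induction n rule: int_induct[where k = 0])
  case (step2 i)
  have "int_sum (\<lambda>k. g (k + 1) - g k) (i - 1) =
      int_sum (\<lambda>k. g (k + 1) - g k) i - (g i - g (i - 1))"
    using int_sum_plus1[of "\<lambda>k. g (k + 1) - g k" "i - 1"] by simp
  then show ?case unfolding step2.IH by simp
qed (simp_all add: int_sum_plus1)

lemma int_sum_add: "int_sum (\<lambda>k. f k + g k) n = int_sum f n + int_sum g n"
  by (simp add: int_sum_def sum.distrib)

lemma int_sum_diff: "int_sum (\<lambda>k. f k - g k) n = int_sum f n - int_sum g n"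
  by (simp add: int_sum_def sum_subtractf)

lemma int_sum_sum: "int_sum (\<lambda>k. \<Sum>i\<in>I. f i k) n = (\<Sum>i\<in>I. int_sum (f i) n)"
  by (simp add: int_sum_def sum_subtractf sum.swap[of _ I])

lemma frag_cmul_diff_distrib2: "frag_cmul c (a - b) = frag_cmul c a - frag_cmul c b"
  using frag_cmul_distrib2[of c a "- b"] by (metis frag_cmul_cmul frag_cmul_minus_one
      minus_frag_cmul mult_minus1_right uminus_add_conv_diff add.commute)

lemma int_sum_cmul: "int_sum (\<lambda>k. frag_cmul c (f k)) n = frag_cmul c (int_sum f n)"
  by (simp add: int_sum_def frag_cmul_diff_distrib2 frag_cmul_sum)

lemma frag_extend_int_sum: "frag_extend h (int_sum f n) = int_sum (\<lambda>k. frag_extend h (f k)) n"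
  by (simp add: int_sum_def frag_extend_diff frag_extend_sum o_def)

lemma keys_int_sum: "Poly_Mapping.keys (int_sum f n) \<subseteq> (\<Union>k. Poly_Mapping.keys (f k))"
  unfolding int_sum_def
  using keys_diff[of "\<Sum>k\<in>{0..<n}. f k" "\<Sum>k\<in>{n..<0}. f k"]
    keys_sum[of f "{0..<n}"] keys_sum[of f "{n..<0}"] by blast

section \<open>Signs of the cubical boundary\<close>

text \<open>Defined for \<open>j\<close> outside \<open>J\<close> as well: there it orients the cell
  obtained by adding the free direction \<open>j\<close>, so one formula serves both boundaries and
  prisms.\<close>

definition axis_sign :: "'n::linorder \<Rightarrow> 'n set \<Rightarrow> int" where
  "axis_sign j J = (-1) ^ card {i\<in>J. i < j}"

lemma axis_sign_square [simp]: "axis_sign j J * axis_sign j J = 1"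
  by (simp add: axis_sign_def flip: power_add mult_2)

lemma axis_sign_insert_self [simp]: "axis_sign j (insert j J) = axis_sign j J"
proof -
  have "{i \<in> insert j J. i < j} = {i\<in>J. i < j}" by auto
  then show ?thesis by (simp add: axis_sign_def)
qed

lemma axis_sign_remove_self [simp]: "axis_sign j (J - {j}) = axis_sign j J"
proof -
  have "{i \<in> J - {j}. i < j} = {i\<in>J. i < j}" by auto
  then show ?thesis by (simp add: axis_sign_def)
qed

lemma axis_sign_insert:
  fixes J :: "'n::{finite,linorder} set"
  assumes "j \<notin> J"
  shows "axis_sign i (insert j J) = (if j < i then - axis_sign i J else axis_sign i J)"
proof (cases "j < i")
  case True
  then have "{k \<in> insert j J. k < i} = insert j {k\<in>J. k < i}" by auto
  with True assms show ?thesis by (simp add: axis_sign_def)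
next
  case False
  then have "{k \<in> insert j J. k < i} = {k\<in>J. k < i}" by auto
  with False show ?thesis by (simp add: axis_sign_def)
qed

text \<open>Exactly one of \<open>i < j\<close> and \<open>j < i\<close> holds, so exactly one of
  the two factors changes sign. This makes the side faces cancel in the homotopy formula.\<close>

lemma axis_sign_swap:
  fixes J :: "'n::{finite,linorder} set"
  assumes "j \<notin> J" "i \<in> J"
  shows "axis_sign j J * axis_sign i (insert j J) = - (axis_sign i J * axis_sign j (J - {i}))"
proof -
  have "axis_sign j J = (if i < j then - axis_sign j (J - {i}) else axis_sign j (J - {i}))"
    using axis_sign_insert[of i "J - {i}" j] assms by (simp add: insert_absorb)
  moreover have "axis_sign i (insert j J) = (if j < i then - axis_sign i J else axis_sign i J)"
    using assms(1) by (rule axis_sign_insert)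
  moreover have "i < j \<longleftrightarrow> \<not> j < i" using assms by (metis linorder_neqE order_less_asym)
  ultimately show ?thesis by (cases "j < i") (simp_all add: mult.commute)
qed

lemma cell_boundary_eq: "cell_boundary (z, J) = (\<Sum>j\<in>J. frag_cmul (axis_sign j J)
     (frag_of (z + axis j 1, J - {j}) - frag_of (z, J - {j})))"
  by (simp add: cell_boundary_def axis_sign_def)

section \<open>Prism homotopy and projections of the grid\<close>

definition set_coord :: "'n \<Rightarrow> int \<Rightarrow> int ^ 'n \<Rightarrow> int ^ 'n::finite" where
  "set_coord j k z = (\<chi> i. if i = j then k else z $ i)"

lemma set_coord_self [simp]: "set_coord j (z $ j) z = z"
  by (simp add: set_coord_def vec_eq_iff)

lemma set_coord_add_axis: "set_coord j k z + axis j 1 = set_coord j (k + 1) z"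
  by (simp add: set_coord_def vec_eq_iff axis_def)

lemma set_coord_of_add_axis:
  "set_coord j k (z + axis i 1) = (if i = j then set_coord j k z else set_coord j k z + axis i 1)"
  by (simp add: set_coord_def vec_eq_iff axis_def)

lemma axis_component: "axis i x $ j = (if i = j then x else 0)"
  by (simp add: axis_def)

text \<open>The prism over a cell in direction \<open>j\<close> reaches down to the
  hyperplane where coordinate \<open>j\<close> is \<open>0\<close>. It is a chain homotopy from the identity to the projection
  \<open>flatten {j}\<close>, and composing over all \<open>j\<close> contracts every chain to the origin.\<close>

definition prism :: "'n \<Rightarrow> 'n::{finite,linorder} cell \<Rightarrow> 'n chain" where
  "prism j = (\<lambda>(z, J). if j \<in> J then 0 else
     frag_cmul (axis_sign j J) (int_sum (\<lambda>k. frag_of (set_coord j k z, insert j J)) (z $ j)))"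

text \<open>The chain map of the projection that sets the coordinates in \<open>S\<close> to 0. A
  cell with a free direction in \<open>S\<close> loses dimension under it, hence the value
  0.\<close>

definition flatten :: "'n set \<Rightarrow> 'n::finite cell \<Rightarrow> 'n chain" where
  "flatten S = (\<lambda>(z, J). if J \<inter> S = {}
     then frag_of (\<chi> i. if i \<in> S then 0 else z $ i, J) else 0)"

lemma flatten_singleton:
  "flatten {j} (z, J) = (if j \<in> J then 0 else frag_of (set_coord j 0 z, J))"
  by (simp add: flatten_def set_coord_def)

text \<open>For \<open>j\<close> outside \<open>J\<close>, the boundary of the prism is its top
  minus its bottom plus its sides, and the sides cancel against the prisms over the faces. For
  \<open>j\<close> in \<open>J\<close>, the prism is 0 and only the two faces orthogonal to
  \<open>j\<close> contribute.\<close>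

lemma boundary_prism_cell:
  "cubical_boundary (prism j (z, J)) + frag_extend (prism j) (cell_boundary (z, J)) =
     frag_of (z, J) - flatten {j} (z, J)"
proof (cases "j \<in> J")
  case True
  have "frag_extend (prism j) (cell_boundary (z, J)) =
      (\<Sum>i\<in>J. frag_cmul (axis_sign i J)
         (prism j (z + axis i 1, J - {i}) - prism j (z, J - {i})))"
    by (simp add: cell_boundary_eq frag_extend_sum frag_extend_cmul frag_extend_diff o_def)
  also have "\<dots> = (\<Sum>i\<in>J. if i = j then frag_of (z, J) else 0)"
  proof (rule sum.cong)
    fix i assume "i \<in> J"
    show "frag_cmul (axis_sign i J) (prism j (z + axis i 1, J - {i}) - prism j (z, J - {i})) =
        (if i = j then frag_of (z, J) else 0)"
    proof (cases "i = j")
      case True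
      \<comment> \<open>The columns below these two faces differ by a single cell, which is
        \<open>(z, J)\<close> itself; its sign occurs squared.\<close>
      then show ?thesis using \<open>i \<in> J\<close>
        by (simp add: prism_def set_coord_of_add_axis int_sum_plus1 axis_component insert_absorb
            flip: frag_cmul_diff_distrib2)
    next
      case False
      with \<open>j \<in> J\<close> show ?thesis by (simp add: prism_def)
    qed
  qed simp
  also have "\<dots> = frag_of (z, J)" using True by simp
  finally show ?thesis using True by (simp add: prism_def flatten_singleton cubical_boundary_def)
next
  case False
  \<comment> \<open>The two sides of the column orthogonal to \<open>i\<close>, upper minus lower,
    still without sign. Both terms of the homotopy formula are expanded in these chains.\<close>
  define T where "T i = int_sum (\<lambda>k. frag_of (set_coord j k z + axis i 1, insert j J - {i}) -
      frag_of (set_coord j k z, insert j J - {i})) (z $ j)" for i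
  have "cell_boundary (set_coord j k z, insert j J) =
      frag_cmul (axis_sign j J) (frag_of (set_coord j (k + 1) z, J) - frag_of (set_coord j k z, J))
      + (\<Sum>i\<in>J. frag_cmul (axis_sign i (insert j J))
          (frag_of (set_coord j k z + axis i 1, insert j J - {i}) -
           frag_of (set_coord j k z, insert j J - {i})))" for k
    using False by (simp add: cell_boundary_eq set_coord_add_axis)
  \<comment> \<open>The horizontal faces between consecutive layers telescope, leaving the top and
    the bottom.\<close>
  then have "cubical_boundary (prism j (z, J)) = frag_cmul (axis_sign j J)
      (frag_cmul (axis_sign j J) (frag_of (z, J) - frag_of (set_coord j 0 z, J))
       + (\<Sum>i\<in>J. frag_cmul (axis_sign i (insert j J)) (T i)))"
    using False int_sum_telescope[of "\<lambda>k. frag_of (set_coord j k z, J)" "z $ j"]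
    by (simp add: prism_def cubical_boundary_def frag_extend_cmul frag_extend_int_sum int_sum_add
        int_sum_cmul int_sum_sum T_def)
  also have "\<dots> = frag_of (z, J) - frag_of (set_coord j 0 z, J)
       + (\<Sum>i\<in>J. frag_cmul (axis_sign j J * axis_sign i (insert j J)) (T i))"
    by (simp add: frag_cmul_distrib2 frag_cmul_sum)
  finally have 1: "cubical_boundary (prism j (z, J)) =
      frag_of (z, J) - frag_of (set_coord j 0 z, J)
       + (\<Sum>i\<in>J. frag_cmul (axis_sign j J * axis_sign i (insert j J)) (T i))" .
  have "frag_extend (prism j) (cell_boundary (z, J)) =
      (\<Sum>i\<in>J. frag_cmul (axis_sign i J)
         (prism j (z + axis i 1, J - {i}) - prism j (z, J - {i})))"
    by (simp add: cell_boundary_eq frag_extend_sum frag_extend_cmul frag_extend_diff o_def)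
  also have "\<dots> = (\<Sum>i\<in>J. frag_cmul (axis_sign i J * axis_sign j (J - {i})) (T i))"
  proof (rule sum.cong)
    fix i assume "i \<in> J"
    with False have "i \<noteq> j" "insert j (J - {i}) = insert j J - {i}" by auto
    with False show "frag_cmul (axis_sign i J)
         (prism j (z + axis i 1, J - {i}) - prism j (z, J - {i})) =
       frag_cmul (axis_sign i J * axis_sign j (J - {i})) (T i)"
      by (simp add: prism_def T_def set_coord_of_add_axis axis_component int_sum_diff
          flip: frag_cmul_diff_distrib2)
  qed simp
  also have "\<dots> = - (\<Sum>i\<in>J. frag_cmul (axis_sign j J * axis_sign i (insert j J)) (T i))"
    using False by (simp add: axis_sign_swap flip: sum_negf)
  finally show ?thesis using False 1 by (simp add: flatten_singleton)
qed

lemma boundary_prism: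
  "cubical_boundary (frag_extend (prism j) c) + frag_extend (prism j) (cubical_boundary c) =
     c - frag_extend (flatten {j}) c"
  using subset_UNIV[of "Poly_Mapping.keys c"]
proof (induction c rule: frag_induction)
  case (one y)
  then show ?case
    using boundary_prism_cell[of j "fst y" "snd y"] by (simp add: cubical_boundary_def)
next
  case (diff c c')
  then show ?case by (simp add: cubical_boundary_def frag_extend_diff algebra_simps)
qed (simp add: cubical_boundary_def)

text \<open>If \<open>j\<close> is in \<open>J\<close>, both sides are 0: the two faces orthogonal
  to \<open>j\<close> have the same image with opposite signs, and every other face still has the
  free direction \<open>j\<close>.\<close>

lemma boundary_flatten_cell:
  "frag_extend cell_boundary (flatten {j} (z, J)) =
     frag_extend (flatten {j}) (cell_boundary (z, J))"
proof (cases "j \<in> J")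
  case True
  then have "flatten {j} (z + axis i 1, J - {i}) = flatten {j} (z, J - {i})" for i
    by (auto simp: flatten_singleton set_coord_of_add_axis)
  with True show ?thesis
    by (simp add: flatten_singleton[of j z J] cell_boundary_eq frag_extend_sum frag_extend_cmul
        frag_extend_diff o_def)
next
  case False
  then have "i \<noteq> j" if "i \<in> J" for i using that by auto
  with False show ?thesis
    by (auto simp: flatten_singleton cell_boundary_eq frag_extend_sum frag_extend_cmul
        frag_extend_diff o_def set_coord_of_add_axis intro!: sum.cong)
qed

lemma boundary_flatten:
  "cubical_boundary (frag_extend (flatten {j}) c) =
     frag_extend (flatten {j}) (cubical_boundary c)"
  using subset_UNIV[of "Poly_Mapping.keys c"]
proof (induction c rule: frag_induction)
  case (one y)
  then show ?case
    using boundary_flatten_cell[of j "fst y" "snd y"] by (simp add: cubical_boundary_def)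
qed (simp_all add: cubical_boundary_def frag_extend_diff)

lemma flatten_empty: "frag_extend (flatten {}) c = c"
proof -
  have "flatten {} = (\<lambda>y :: 'a cell. frag_of y)"
    by (auto simp: flatten_def fun_eq_iff)
  then show ?thesis by (metis frag_expansion)
qed

lemma flatten_insert:
  "frag_extend (flatten (insert j S)) c = frag_extend (flatten {j}) (frag_extend (flatten S) c)"
  using subset_UNIV[of "Poly_Mapping.keys c"]
proof (induction c rule: frag_induction)
  case (one y)
  show ?case
    by (cases y) (auto simp: flatten_def vec_eq_iff frag_of_eq)
qed (simp_all add: frag_extend_diff)

section \<open>Reduced cycles are boundaries\<close>

lemma cell_chains_prism:
  assumes "c \<in> cell_chains d"
  shows "frag_extend (prism j) c \<in> cell_chains (Suc d)"
proof -
  have "Poly_Mapping.keys (prism j (z, J)) \<subseteq> cells (Suc d)" if "card J = d" for z J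
  proof (cases "j \<in> J")
    case False
    have "Poly_Mapping.keys (prism j (z, J)) \<subseteq>
        Poly_Mapping.keys (int_sum (\<lambda>k. frag_of (set_coord j k z, insert j J)) (z $ j))"
      using False keys_cmul by (fastforce simp: prism_def)
    also have "\<dots> \<subseteq> (\<Union>k. {(set_coord j k z, insert j J)})"
      using keys_int_sum[of "\<lambda>k. frag_of (set_coord j k z, insert j J)"] by simp
    also have "\<dots> \<subseteq> cells (Suc d)" using False that by (auto simp: cells_def)
    finally show ?thesis .
  qed (simp add: prism_def)
  moreover have "Poly_Mapping.keys (frag_extend (prism j) c) \<subseteq>
      (\<Union>y\<in>Poly_Mapping.keys c. Poly_Mapping.keys (prism j y))"
    by (rule keys_frag_extend)
  ultimately show ?thesis using assms by (fastforce simp: cell_chains_def cells_def)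
qed

lemma cell_chains_flatten:
  assumes "c \<in> cell_chains d"
  shows "frag_extend (flatten S) c \<in> cell_chains d"
proof -
  have "Poly_Mapping.keys (flatten S (z, J)) \<subseteq> cells d" if "card J = d" for z J
    using that by (auto simp: flatten_def cells_def)
  moreover have "Poly_Mapping.keys (frag_extend (flatten S) c) \<subseteq>
      (\<Union>y\<in>Poly_Mapping.keys c. Poly_Mapping.keys (flatten S y))"
    by (rule keys_frag_extend)
  ultimately show ?thesis using assms by (fastforce simp: cell_chains_def cells_def)
qed

lemma cell_chains_add:
  "c \<in> cell_chains d \<Longrightarrow> c' \<in> cell_chains d \<Longrightarrow> c + c' \<in> cell_chains d"
  using Poly_Mapping.keys_add[of c c'] by (auto simp: cell_chains_def)

text \<open>The directions in \<open>S\<close> are collapsed one at a time; each contributes the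
  prism over the cycle flattened so far.\<close>

lemma flatten_homologous:
  fixes \<zeta> :: "'n::{finite,linorder} chain"
  assumes "\<zeta> \<in> cell_chains d" "cubical_boundary \<zeta> = 0" "finite S"
  shows "\<exists>\<beta>\<in>cell_chains (Suc d). cubical_boundary \<beta> = \<zeta> - frag_extend (flatten S) \<zeta>"
proof -
  \<comment> \<open>The induction must also carry that the flattened chain is a cycle, since this
    removes the prism of its boundary from \<open>boundary_prism\<close>.\<close>
  have "(\<exists>\<beta>\<in>cell_chains (Suc d). cubical_boundary \<beta> = \<zeta> - frag_extend (flatten S) \<zeta>) \<and>
      cubical_boundary (frag_extend (flatten S) \<zeta>) = 0"
    using assms(3)
  proof induction
    case empty
    have "0 \<in> cell_chains (Suc d)" by (simp add: cell_chains_def)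
    then show ?case using assms by (auto simp: flatten_empty cubical_boundary_def intro!: bexI[of _ 0])
  next
    case (insert j S)
    define \<xi> where "\<xi> = frag_extend (flatten S) \<zeta>"
    from insert obtain \<beta> where \<beta>: "\<beta> \<in> cell_chains (Suc d)" "cubical_boundary \<beta> = \<zeta> - \<xi>"
      and \<xi>: "cubical_boundary \<xi> = 0" by (auto simp: \<xi>_def)
    have "cubical_boundary (\<beta> + frag_extend (prism j) \<xi>) = \<zeta> - frag_extend (flatten {j}) \<xi>"
      using \<beta>(2) boundary_prism[of j \<xi>] \<xi>
      by (simp add: cubical_boundary_def frag_extend_add)
    moreover have "\<beta> + frag_extend (prism j) \<xi> \<in> cell_chains (Suc d)"
      using \<beta>(1) assms(1) by (simp add: cell_chains_add cell_chains_prism cell_chains_flatten \<xi>_def)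
    moreover have "cubical_boundary (frag_extend (flatten {j}) \<xi>) = 0"
      using \<xi> by (simp add: boundary_flatten)
    ultimately show ?case unfolding flatten_insert[of j S] \<xi>_def by blast
  qed
  then show ?thesis by blast
qed

text \<open>For \<open>d > 0\<close> every cell has a free direction and collapses. For
  \<open>d = 0\<close> all vertices move to the origin, where the coefficients add up to 0.\<close>

lemma flatten_UNIV_reduced_cycle:
  fixes \<zeta> :: "'n::{finite,linorder} chain"
  assumes "reduced_cycle d \<zeta>"
  shows "frag_extend (flatten UNIV) \<zeta> = 0"
proof (cases "d = 0")
  case False
  with assms show ?thesis
    by (intro frag_extend_eq_0)
      (auto simp: reduced_cycle_def cell_chains_def cells_def flatten_def)
next
  case True
  have cmul_sum: "(\<Sum>y\<in>I. frag_cmul (f y) x) = frag_cmul (sum f I) x"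
    for I and f :: "'n cell \<Rightarrow> int" and x :: "'n chain"
    by (induction I rule: infinite_finite_induct) (simp_all add: frag_cmul_distrib)
  have "frag_extend (flatten UNIV) \<zeta> = frag_extend (\<lambda>_. frag_of (0, {})) \<zeta>"
    using assms True by (intro frag_extend_eq)
      (auto simp: reduced_cycle_def cell_chains_def cells_def flatten_def vec_eq_iff frag_of_eq)
  also have "\<dots> = frag_cmul (\<Sum>y\<in>Poly_Mapping.keys \<zeta>. Poly_Mapping.lookup \<zeta> y) (frag_of (0, {}))"
    by (simp add: frag_extend_def cmul_sum)
  also have "\<dots> = 0" using assms True by (simp add: reduced_cycle_def)
  finally show ?thesis .
qed

text \<open>The top degree is covered too: there \<open>cell_chains (Suc d)\<close> contains only 0,
  so 0 is the only reduced cycle.\<close>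

lemma reduced_cycle_imp_boundary:
  fixes \<zeta> :: "'n::{finite,linorder} chain"
  assumes "reduced_cycle d \<zeta>"
  obtains \<beta> where "\<beta> \<in> cell_chains (Suc d)" "cubical_boundary \<beta> = \<zeta>"
  using flatten_homologous[of \<zeta> d UNIV] assms flatten_UNIV_reduced_cycle[OF assms]
  by (auto simp: reduced_cycle_def)

section \<open>Additive functions on chains\<close>

lemma keys_sum_cmul_frag_of:
  "Poly_Mapping.keys (\<Sum>y\<in>I. frag_cmul (k y) (frag_of y)) \<subseteq> I"
proof -
  have "Poly_Mapping.keys (\<Sum>y\<in>I. frag_cmul (k y) (frag_of y)) \<subseteq>
      (\<Union>y\<in>I. Poly_Mapping.keys (frag_cmul (k y) (frag_of y)))"
    by (rule keys_sum)
  also have "\<dots> \<subseteq> I" using keys_cmul by fastforce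
  finally show ?thesis .
qed

text \<open>Brings the value of a cocycle into the cellwise form of \<open>rule_value\<close>.
  Additivity is available on \<open>cell_chains d\<close> only, so all partial sums and multiples
  are checked to stay there.\<close>

lemma additive_on_cell_chains_eq:
  fixes \<phi> :: "'n::finite chain \<Rightarrow> 'g::ab_group_add"
  assumes add: "\<And>\<zeta> \<zeta>'. \<zeta> \<in> cell_chains d \<Longrightarrow> \<zeta>' \<in> cell_chains d \<Longrightarrow> \<phi> (\<zeta> + \<zeta>') = \<phi> \<zeta> + \<phi> \<zeta>'"
    and \<zeta>: "\<zeta> \<in> cell_chains d"
  shows "\<phi> \<zeta> = (\<Sum>y\<in>Poly_Mapping.keys \<zeta>. int_scale (Poly_Mapping.lookup \<zeta> y) (\<phi> (frag_of y)))"
proof -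
  have mem0: "0 \<in> cell_chains d" by (simp add: cell_chains_def)
  have zero: "\<phi> 0 = 0" using add[OF mem0 mem0] by simp
  have mem: "frag_cmul k c \<in> cell_chains d" if "c \<in> cell_chains d" for k c
    using that keys_cmul[of k c] by (auto simp: cell_chains_def)
  have scale_nat: "\<phi> (frag_cmul (int n) c) = (\<Sum>_<n. \<phi> c)" if "c \<in> cell_chains d" for n c
  proof (induction n)
    case (Suc n)
    then show ?case using add[OF mem[OF that, of "int n"] that]
      by (simp add: frag_cmul_distrib add.commute)
  qed (simp add: zero)
  have scale: "\<phi> (frag_cmul k c) = int_scale k (\<phi> c)" if c: "c \<in> cell_chains d" for k c
  proof (cases "k \<ge> 0")
    case True
    then show ?thesis using scale_nat[OF c, of "nat k"] by (simp add: int_scale_def)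
  next
    case False
    have "\<phi> (frag_cmul k c) + \<phi> (frag_cmul (- k) c) = 0"
      using add[OF mem[OF c, of k] mem[OF c, of "- k"]] zero by (simp flip: frag_cmul_distrib)
    moreover have "\<phi> (frag_cmul (- k) c) = (\<Sum>_<nat (- k). \<phi> c)"
      using scale_nat[OF c, of "nat (- k)"] False by simp
    ultimately show ?thesis using False by (simp add: int_scale_def eq_neg_iff_add_eq_0)
  qed
  have sum: "\<phi> (\<Sum>y\<in>I. frag_cmul (k y) (frag_of y)) = (\<Sum>y\<in>I. int_scale (k y) (\<phi> (frag_of y)))"
    if "finite I" "I \<subseteq> cells d" for I and k :: "'n cell \<Rightarrow> int"
    using that
  proof induction
    case (insert y I)
    have "frag_of y \<in> cell_chains d" using insert by (simp add: cell_chains_def)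
    moreover have "(\<Sum>y\<in>I. frag_cmul (k y) (frag_of y)) \<in> cell_chains d"
      using insert keys_sum_cmul_frag_of[of k I] by (auto simp: cell_chains_def)
    ultimately show ?case using insert by (simp add: add mem scale)
  qed (simp add: zero)
  have "\<phi> \<zeta> = \<phi> (frag_extend frag_of \<zeta>)" by (simp flip: frag_expansion)
  also have "\<dots> = (\<Sum>y\<in>Poly_Mapping.keys \<zeta>. int_scale (Poly_Mapping.lookup \<zeta> y) (\<phi> (frag_of y)))"
    using \<zeta> by (simp add: frag_extend_def sum cell_chains_def)
  finally show ?thesis .
qed

section \<open>Good points and local rules\<close>

lemma cube_mono: "r \<le> s \<Longrightarrow> cube r \<subseteq> cube s"
  by (auto simp: cube_def) (meson of_nat_mono order_trans)

lemma cube_add: "u \<in> cube r \<Longrightarrow> v \<in> cube s \<Longrightarrow> u + v \<in> cube (r + s)"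
  by (auto simp: cube_def) (meson abs_triangle_ineq add_mono order_trans)

lemma partial_cube_subset: "partial_cube J r \<subseteq> cube r"
  by (auto simp: partial_cube_def)

lemma restrict_eq_iff: "restrict f U = restrict g U \<longleftrightarrow> (\<forall>u\<in>U. f u = g u)"
  by (auto simp: restrict_def fun_eq_iff)

text \<open>If no admissible radius were at least \<open>r\<close>, the supremum would be at most
  \<open>r - 1\<close>; a larger admissible radius restricts to \<open>r\<close>. At
  \<open>r = 0\<close> the equivalence can fail, because every point is then good, even if its
  letter does not occur in \<open>A\<close>.\<close>

lemma good_iff:
  assumes "r > 0"
  shows "z \<in> good A r a \<longleftrightarrow> (\<exists>b\<in>A. \<forall>u\<in>cube r. b u = a (u + z))"
proof -
  let ?P = "\<lambda>r. \<exists>b\<in>A. \<forall>u\<in>cube r. b u = a (u + z)"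
  have pat: "restrict (shift z a) (cube r) \<in> patterns A (cube r) \<longleftrightarrow> ?P r" for r
    by (simp add: patterns_def image_iff restrict_eq_iff shift_def eq_commute[of _ "a _"])
  have "z \<in> good A r a \<longleftrightarrow> enat r \<le> (SUP r \<in> {r. ?P r}. enat r)"
    by (simp add: good_def admissible_radius_def pat)
  also have "\<dots> \<longleftrightarrow> ?P r"
  proof
    assume le: "enat r \<le> (SUP r \<in> {r. ?P r}. enat r)"
    have "\<exists>s\<ge>r. ?P s"
    proof (rule ccontr)
      assume none: "\<not> (\<exists>s\<ge>r. ?P s)"
      have "(SUP r \<in> {r. ?P r}. enat r) \<le> enat (r - 1)"
      proof (rule SUP_least)
        fix s assume "s \<in> {r. ?P r}"
        with none have "\<not> s \<ge> r" by blast
        then show "enat s \<le> enat (r - 1)" by simp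
      qed
      with le have "enat r \<le> enat (r - 1)" by (rule order_trans)
      with assms show False by simp
    qed
    then show "?P r" using cube_mono by blast
  next
    assume "?P r"
    then show "enat r \<le> (SUP r \<in> {r. ?P r}. enat r)" by (intro SUP_upper) auto
  qed
  finally show ?thesis .
qed

lemma subshift_shift: "subshift A \<Longrightarrow> b \<in> A \<Longrightarrow> shift v b \<in> A"
  by (auto simp: subshift_def)

text \<open>The cube of radius \<open>r\<close> around \<open>u + z\<close> lies in the cube of
  radius \<open>r + s\<close> around \<open>z\<close>, so a shift of the witness for
  \<open>z\<close> is a witness for \<open>u + z\<close>.\<close>

lemma good_add_cube:
  assumes "subshift A" "r > 0" "z \<in> good A (r + s) a" "u \<in> cube s"
  shows "u + z \<in> good A r a"
proof -
  obtain b where b: "b \<in> A" "\<forall>u\<in>cube (r + s). b u = a (u + z)"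
    using assms good_iff[of "r + s" z A a] by auto
  have "shift u b v = a (v + (u + z))" if "v \<in> cube r" for v
    using b(2) cube_add[OF that assms(4)] by (simp add: shift_def add.assoc)
  with subshift_shift[OF assms(1) b(1)] show ?thesis
    using good_iff[OF assms(2)] by blast
qed

lemma base_in_cell_vertices: "z \<in> cell_vertices (z, J)"
  by (auto simp: cell_vertices_def cell_body_def image_iff intro!: exI[of _ 0])

text \<open>The radius \<open>r + s\<close> leaves room for two things at once: the cube of radius \<open>s\<close> around a good
  point consists of points of \<open>good A r a\<close>, where \<open>a'\<close> agrees with \<open>a\<close>, and the value of the rule
  of radius \<open>r + s\<close> there depends only on this smaller cube.\<close>

lemma local_rule_value_repaired:
  assumes "subshift A" "r > 0" "a' \<in> A" "\<forall>z\<in>good A r a. a' z = a z"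
    and rs: "local_rule A d C (r + s) c" and s: "local_rule A d C s c0"
    and "card J = d" "z \<in> good A (r + s) a"
  shows "c J (restrict (shift z a) (partial_cube J (r + s))) = C (frag_of (z, J)) a'"
proof -
  obtain b where b: "b \<in> A" "\<forall>u\<in>cube (r + s). b u = a (u + z)"
    using assms good_iff[of "r + s" z A a] by auto
  have shift0: "shift 0 b = b" by (simp add: shift_def)
  have "restrict (shift z a) (partial_cube J (r + s)) = restrict b (partial_cube J (r + s))"
    using b(2) partial_cube_subset by (fastforce simp: restrict_eq_iff shift_def)
  \<comment> \<open>The element \<open>b\<close> of \<open>A\<close> links the two rules: at
    \<open>b\<close> both compute \<open>C\<close>, which allows passing from radius
    \<open>r + s\<close> to radius \<open>s\<close>.\<close>
  then have "c J (restrict (shift z a) (partial_cube J (r + s))) = C (frag_of (0, J)) b"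
    using rs b(1) \<open>card J = d\<close> shift0 unfolding local_rule_def by metis
  also have "\<dots> = c0 J (restrict b (partial_cube J s))"
    using s b(1) \<open>card J = d\<close> shift0 unfolding local_rule_def by metis
  also have "restrict b (partial_cube J s) = restrict (shift z a') (partial_cube J s)"
  proof -
    have "b u = a' (u + z)" if "u \<in> partial_cube J s" for u
    proof -
      have u: "u \<in> cube s" using that partial_cube_subset by blast
      then have "b u = a (u + z)" using b(2) cube_mono[of s "r + s"] by auto
      also have "\<dots> = a' (u + z)" using good_add_cube[OF assms(1,2,8) u] assms(4) by simp
      finally show ?thesis .
    qed
    then show ?thesis by (simp add: restrict_eq_iff shift_def)
  qed
  also have "c0 J \<dots> = C (frag_of (z, J)) a'"
    using s assms(3) \<open>card J = d\<close> unfolding local_rule_def by metis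
  finally show ?thesis .
qed

section \<open>A removable defect excludes projective poles\<close>

theorem proposition4p9:
  fixes A :: "('a::finite, 'n::{finite,linorder}) config set"
    and a :: "('a, 'n) config" and d :: nat
  assumes "subshift A"
    and "d \<le> CARD('n)"
    and "a \<in> defect_configs A"
    and "has_projective_pole TYPE('g::topological_ab_group_add) A d a"
  shows "essential_defect A a"
  unfolding essential_defect_def
proof
  assume "removable_defect A a"
  then obtain r a' where r: "r > 0" and a': "a' \<in> A" "\<forall>z\<in>good A r a. a' z = a z"
    by (auto simp: removable_defect_def)
  obtain C :: "'n chain \<Rightarrow> ('a, 'n) config \<Rightarrow> 'g" and s
    where C: "eq_cocycle A d C" and pole: "\<And>t. t \<ge> s \<Longrightarrow> has_pole A d C t a"
    using assms(4) by (auto simp: has_projective_pole_def eventually_sequentially)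
  \<comment> \<open>Of the pole of range \<open>s\<close> only the local rule is kept; the
    contradiction comes from the pole of range \<open>r + s\<close>.\<close>
  obtain c0 where c0: "local_rule A d C s c0"
    using pole[of s] by (auto simp: has_pole_def)
  obtain c \<zeta> where c: "local_rule A d C (r + s) c" and \<zeta>: "reduced_cycle d \<zeta>"
    and good: "\<forall>y\<in>Poly_Mapping.keys \<zeta>. cell_vertices y \<subseteq> good A (r + s) a"
    and nz: "rule_value (r + s) c \<zeta> a \<noteq> 0"
    using pole[of "r + s"] by (auto simp: has_pole_def)
  have \<zeta>d: "\<zeta> \<in> cell_chains d" using \<zeta> by (simp add: reduced_cycle_def)
  have "rule_value (r + s) c \<zeta> a =
      (\<Sum>y\<in>Poly_Mapping.keys \<zeta>. int_scale (Poly_Mapping.lookup \<zeta> y) (C (frag_of y) a'))"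
    unfolding rule_value_def
  proof (rule sum.cong)
    fix y assume y: "y \<in> Poly_Mapping.keys \<zeta>"
    obtain z J where zJ: "y = (z, J)" by (cases y)
    have "card J = d" using y \<zeta>d by (auto simp: zJ cell_chains_def cells_def)
    moreover have "z \<in> good A (r + s) a"
      using y good base_in_cell_vertices[of z J] by (auto simp: zJ)
    ultimately have "c J (restrict (shift z a) (partial_cube J (r + s))) = C (frag_of (z, J)) a'"
      by (rule local_rule_value_repaired[OF assms(1) r a' c c0])
    then show "(case y of (z, J) \<Rightarrow> int_scale (Poly_Mapping.lookup \<zeta> (z, J))
        (c J (restrict (shift z a) (partial_cube J (r + s))))) =
      int_scale (Poly_Mapping.lookup \<zeta> y) (C (frag_of y) a')"
      by (simp add: zJ)
  qed simp
  also have "\<dots> = C \<zeta> a'"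
    using C a'(1) \<zeta>d
    by (intro additive_on_cell_chains_eq[where \<phi> = "\<lambda>\<zeta>. C \<zeta> a'", symmetric])
      (auto simp: eq_cocycle_def)
  \<comment> \<open>A chain bounded by \<zeta> may cross the defect of \<open>a\<close>; the cocycle
    condition still applies, because it is used at \<open>a'\<close>, an element of
    \<open>A\<close>.\<close>
  also have "\<dots> = 0"
    using reduced_cycle_imp_boundary[OF \<zeta>] C a'(1) unfolding eq_cocycle_def by metis
  finally show False using nz by simp
qed

end
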